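(* Let $V\subset\mathbb{R}^n$ be a tropical variety of dimension $k<n$. For any point $A\in\mathbb{R}^n$, $$\sum_F \rho_A(F)=0\quad\text{in}\quad \mathbb{R}^{\binom{n}{k+1}}\otimes_{\mathbb{Z}}\mathfrak{G}(V),$$ where $F$ runs over all the unbounded faces of $V$ of the maximal dimension $k$.
   Context: A tropical variety $V\subset\mathbb{R}^n$ of dimension $k$ is a finite pure $k$-dimensional rational polyhedral complex whose maximal faces $F$ carry positive integer weights $w(F)$, satisfying the balancing condition: for each face $G$ of codimension one in $V$, with $F_1,\dots,F_l$ the maximal faces containing $G$ and $v_G(F_i)$ an integer vector pointing from $G$ into $F_i$ which together with the lattice of $G$ generates the lattice of $F_i$, the sum $\sum_i w(F_i)v_G(F_i)$ is parallel to $G$. Generalized cross product: given $j\le n$ vectors $v_1,\dots,v_j\in\mathbb{R}^n$, it is the vector in $\mathbb{R}^{\binom{n}{j}}$ of all $j\times j$ minors of the $j\times n$ matrix with rows $v_1,\dots,v_j$. Choose, for each face of $V$ of codimension zero or one, a basis of the lattice of integer vectors parallel to that face. For a maximal face $F$ and a codimension-one face $G\subset F$, let $s_G(F)\in\{+1,-1\}$ be $+1$ if the basis of $G$ with the vector $v_G(F)$ added at the last place gives the same orientation of $F$ as the chosen basis of $F$, and $-1$ otherwise. $\mathfrak{G}(V)$ is the abelian group generated by all codimension-one faces $G$ of $V$, with relations $m(F)=0$ for every bounded maximal face $F$ of $V$, where for any maximal face $F$ one sets $m(F)=\sum_{G\subset F}s_G(F)\cdot G$ (sum over codimension-one faces $G$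 of $V$ contained in $F$). For a point $A$ and a maximal face $F$, pick $B\in F$ and let $r_A(F)\in\mathbb{R}^{\binom{n}{k+1}}$ be the generalized cross product of the vector $AB$ and the vectors of the chosen basis of $F$ (in this order); it does not depend on $B$. Set $\rho_A(F)=w(F)\,r_A(F)\otimes m(F)$. *)

theory Defs
  imports
    "HOL-Analysis.Analysis"
    "HOL-Algebra.Algebra"
    "HOL-Computational_Algebra.Group_Closure"
    "Jordan_Normal_Form.Determinant"
begin

no_notation Matrix.vec_index (infixl \<open>$\<close> 100)

text \<open>
  The ambient space \<open>\<real>\<^sup>n\<close> is the type \<open>'n rvec\<close> with \<open>n = CARD('n)\<close>.  The index type is linearly
  ordered wherever minors are taken, since the sign of a minor depends on the order of its columns.
\<close>

type_synonym 'n rvec = "real ^ 'n"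

subsection \<open>Polyhedral complexes and integer lattices\<close>

definition integer_vector :: "'n::finite rvec \<Rightarrow> bool" where
  "integer_vector x \<longleftrightarrow> (\<forall>i. x $ i \<in> \<int>)"

text \<open>
  As \<^const>\<open>polyhedron\<close>, but with integer normal vectors; the constants \<open>b\<close> are arbitrary reals,
  as usual in tropical geometry.
\<close>

definition rational_polyhedron :: "'n::finite rvec set \<Rightarrow> bool" where
  "rational_polyhedron S \<longleftrightarrow>
     (\<exists>H. finite H \<and> S = \<Inter>H \<and>
          (\<forall>h\<in>H. \<exists>a b. a \<noteq> 0 \<and> integer_vector a \<and> h = {x. a \<bullet> x \<le> b}))"

text \<open>
  The complex is the set of its nonempty faces.  The empty set is a face of every set in the sense
  of \<^const>\<open>face_of\<close>, so two faces may be disjoint.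
\<close>

definition rational_polyhedral_complex :: "'n::finite rvec set set \<Rightarrow> bool" where
  "rational_polyhedral_complex V \<longleftrightarrow>
     finite V \<and>
     (\<forall>S\<in>V. S \<noteq> {} \<and> rational_polyhedron S) \<and>
     (\<forall>S\<in>V. \<forall>T. T face_of S \<and> T \<noteq> {} \<longrightarrow> T \<in> V) \<and>
     (\<forall>S\<in>V. \<forall>T\<in>V. (S \<inter> T) face_of S \<and> (S \<inter> T) face_of T)"

definition faces_of_dim :: "int \<Rightarrow> 'n::finite rvec set set \<Rightarrow> 'n rvec set set" where
  "faces_of_dim d V = {S \<in> V. aff_dim S = d}"

definition pure_of_dim :: "nat \<Rightarrow> 'n::finite rvec set set \<Rightarrow> bool" where
  "pure_of_dim k V \<longleftrightarrow> (\<forall>S\<in>V. \<exists>F\<in>faces_of_dim (int k) V. S \<subseteq> F)"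

abbreviation maximal_faces :: "nat \<Rightarrow> 'n::finite rvec set set \<Rightarrow> 'n rvec set set" where
  "maximal_faces k V \<equiv> faces_of_dim (int k) V"

abbreviation codim_one_faces :: "nat \<Rightarrow> 'n::finite rvec set set \<Rightarrow> 'n rvec set set" where
  "codim_one_faces k V \<equiv> faces_of_dim (int k - 1) V"

definition direction_space :: "'n::finite rvec set \<Rightarrow> 'n rvec set" where
  "direction_space S = span {x - y | x y. x \<in> S \<and> y \<in> S}"

definition face_integer_lattice :: "'n::finite rvec set \<Rightarrow> 'n rvec set" where
  "face_integer_lattice S = {x \<in> direction_space S. integer_vector x}"

definition lattice_basis :: "'n::finite rvec set \<Rightarrow> 'n rvec list \<Rightarrow> bool" where
  "lattice_basis S bs \<longleftrightarrow>
     distinct bs \<and> independent (set bs) \<and> group_closure (set bs) = face_integer_lattice S"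

subsection \<open>Tropical varieties\<close>

text \<open>
  The vectors \<open>v\<^sub>G(F)\<close>; they are determined by \<open>G\<close> and \<open>F\<close> only up to the lattice of \<open>G\<close>.
\<close>

definition primitive_vector :: "'n::finite rvec set \<Rightarrow> 'n rvec set \<Rightarrow> 'n rvec \<Rightarrow> bool" where
  "primitive_vector G F v \<longleftrightarrow>
     integer_vector v \<and>
     (\<exists>x\<in>G. \<exists>e>0. x + e *\<^sub>R v \<in> F) \<and>
     group_closure (insert v (face_integer_lattice G)) = face_integer_lattice F"

definition balanced_at ::
  "nat \<Rightarrow> 'n::finite rvec set set \<Rightarrow> ('n rvec set \<Rightarrow> nat) \<Rightarrow> 'n rvec set \<Rightarrow> bool" where
  "balanced_at k V w G \<longleftrightarrow>
     (\<forall>u. (\<forall>F\<in>maximal_faces k V. G \<subseteq> F \<longrightarrow> primitive_vector G F (u F)) \<longrightarrow>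
          (\<Sum>F\<in>{F \<in> maximal_faces k V. G \<subseteq> F}. real (w F) *\<^sub>R u F) \<in> direction_space G)"

definition tropical_variety ::
  "nat \<Rightarrow> 'n::finite rvec set set \<Rightarrow> ('n rvec set \<Rightarrow> nat) \<Rightarrow> bool" where
  "tropical_variety k V w \<longleftrightarrow>
     rational_polyhedral_complex V \<and> pure_of_dim k V \<and>
     (\<forall>F\<in>maximal_faces k V. 0 < w F) \<and>
     (\<forall>G\<in>codim_one_faces k V. balanced_at k V w G)"

subsection \<open>Orientations and the generalized cross product\<close>

definition same_orientation :: "'n::finite rvec list \<Rightarrow> 'n rvec list \<Rightarrow> bool" where
  "same_orientation bs cs \<longleftrightarrow>
     (\<exists>M \<in> carrier_mat (length cs) (length bs).
        (\<forall>j<length bs. bs ! j = (\<Sum>i<length cs. M $$ (i, j) *\<^sub>R (cs ! i))) \<and>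
        0 < Determinant.det M)"

definition orientation_sign :: "'n::finite rvec list \<Rightarrow> 'n rvec \<Rightarrow> 'n rvec list \<Rightarrow> int" where
  "orientation_sign bG v bF = (if same_orientation (bG @ [v]) bF then 1 else - 1)"

text \<open>
  A vector of \<open>\<real>\<close> to the power \<open>n choose j\<close> is a function on sets of columns that vanishes off the
  sets with \<open>j\<close> elements; \<open>minor_space j\<close> is the additive group of these vectors, written
  multiplicatively as all groups of HOL-Algebra.
\<close>

definition minor_space :: "nat \<Rightarrow> ('n::finite set \<Rightarrow> real) monoid" where
  "minor_space j =
     \<lparr>carrier = {f. \<forall>J. card J \<noteq> j \<longrightarrow> f J = 0}, monoid.mult = (\<lambda>f g J. f J + g J), one = (\<lambda>_. 0)\<rparr>"

definition generalized_cross :: "'n::{finite,linorder} rvec list \<Rightarrow> 'n set \<Rightarrow> real" where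
  "generalized_cross vs J =
     (if card J = length vs
      then Determinant.det (mat (length vs) (length vs)
             (\<lambda>(r, c). (vs ! r) $ (sorted_list_of_set J ! c)))
      else 0)"

subsection \<open>Presented abelian groups and tensor products over the integers\<close>

definition presented_relations :: "'a set \<Rightarrow> ('a \<Rightarrow>\<^sub>0 int) set \<Rightarrow> ('a \<Rightarrow>\<^sub>0 int) set" where
  "presented_relations S R = generate (free_Abelian_group S) R"

definition presented_group :: "'a set \<Rightarrow> ('a \<Rightarrow>\<^sub>0 int) set \<Rightarrow> ('a \<Rightarrow>\<^sub>0 int) set monoid" where
  "presented_group S R = free_Abelian_group S Mod presented_relations S R"

definition presented_class :: "'a set \<Rightarrow> ('a \<Rightarrow>\<^sub>0 int) set \<Rightarrow> ('a \<Rightarrow>\<^sub>0 int) \<Rightarrow> ('a \<Rightarrow>\<^sub>0 int) set" where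
  "presented_class S R x = presented_relations S R #>\<^bsub>free_Abelian_group S\<^esub> x"

definition bilinear_relations ::
  "('a, 'm) monoid_scheme \<Rightarrow> ('b, 'l) monoid_scheme \<Rightarrow> (('a \<times> 'b) \<Rightarrow>\<^sub>0 int) set" where
  "bilinear_relations A B =
     {frag_of (a \<otimes>\<^bsub>A\<^esub> a', b) - frag_of (a, b) - frag_of (a', b) | a a' b.
        a \<in> carrier A \<and> a' \<in> carrier A \<and> b \<in> carrier B} \<union>
     {frag_of (a, b \<otimes>\<^bsub>B\<^esub> b') - frag_of (a, b) - frag_of (a, b') | a b b'.
        a \<in> carrier A \<and> b \<in> carrier B \<and> b' \<in> carrier B}"

definition tensor_group ::
  "('a, 'm) monoid_scheme \<Rightarrow> ('b, 'l) monoid_scheme \<Rightarrow> (('a \<times> 'b) \<Rightarrow>\<^sub>0 int) set monoid" where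
  "tensor_group A B = presented_group (carrier A \<times> carrier B) (bilinear_relations A B)"

definition pure_tensor ::
  "('a, 'm) monoid_scheme \<Rightarrow> ('b, 'l) monoid_scheme \<Rightarrow> 'a \<Rightarrow> 'b \<Rightarrow> (('a \<times> 'b) \<Rightarrow>\<^sub>0 int) set" where
  "pure_tensor A B a b =
     presented_class (carrier A \<times> carrier B) (bilinear_relations A B) (frag_of (a, b))"

subsection \<open>The group of codimension-one faces and the moments\<close>

text \<open>
  Throughout, \<open>b S\<close> is the chosen basis of the lattice of \<open>S\<close>, \<open>v G F\<close> the chosen vector
  \<open>v\<^sub>G(F)\<close>, and \<open>p F\<close> the chosen point of \<open>F\<close>.
\<close>

definition face_chain ::
  "nat \<Rightarrow> 'n::finite rvec set set \<Rightarrow> ('n rvec set \<Rightarrow> 'n rvec list) \<Rightarrow>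
   ('n rvec set \<Rightarrow> 'n rvec set \<Rightarrow> 'n rvec) \<Rightarrow> 'n rvec set \<Rightarrow>
   ('n rvec set \<Rightarrow>\<^sub>0 int)" where
  "face_chain k V b v F =
     (\<Sum>G\<in>{G \<in> codim_one_faces k V. G \<subseteq> F}.
        frag_cmul (orientation_sign (b G) (v G F) (b F)) (frag_of G))"

definition bounded_relations ::
  "nat \<Rightarrow> 'n::finite rvec set set \<Rightarrow> ('n rvec set \<Rightarrow> 'n rvec list) \<Rightarrow>
   ('n rvec set \<Rightarrow> 'n rvec set \<Rightarrow> 'n rvec) \<Rightarrow> ('n rvec set \<Rightarrow>\<^sub>0 int) set" where
  "bounded_relations k V b v = face_chain k V b v ` {F \<in> maximal_faces k V. bounded F}"

definition codim_one_group ::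
  "nat \<Rightarrow> 'n::finite rvec set set \<Rightarrow> ('n rvec set \<Rightarrow> 'n rvec list) \<Rightarrow>
   ('n rvec set \<Rightarrow> 'n rvec set \<Rightarrow> 'n rvec) \<Rightarrow> ('n rvec set \<Rightarrow>\<^sub>0 int) set monoid" where
  "codim_one_group k V b v = presented_group (codim_one_faces k V) (bounded_relations k V b v)"

definition face_element ::
  "nat \<Rightarrow> 'n::finite rvec set set \<Rightarrow> ('n rvec set \<Rightarrow> 'n rvec list) \<Rightarrow>
   ('n rvec set \<Rightarrow> 'n rvec set \<Rightarrow> 'n rvec) \<Rightarrow> 'n rvec set \<Rightarrow>
   ('n rvec set \<Rightarrow>\<^sub>0 int) set" where
  "face_element k V b v F =
     presented_class (codim_one_faces k V) (bounded_relations k V b v) (face_chain k V b v F)"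

definition moment_vector ::
  "'n::{finite,linorder} rvec \<Rightarrow> 'n rvec \<Rightarrow> 'n rvec list \<Rightarrow> 'n set \<Rightarrow> real" where
  "moment_vector A B bF = generalized_cross ((B - A) # bF)"

definition moment_group ::
  "nat \<Rightarrow> 'n::{finite,linorder} rvec set set \<Rightarrow> ('n rvec set \<Rightarrow> 'n rvec list) \<Rightarrow>
   ('n rvec set \<Rightarrow> 'n rvec set \<Rightarrow> 'n rvec) \<Rightarrow>
   ((('n set \<Rightarrow> real) \<times> ('n rvec set \<Rightarrow>\<^sub>0 int) set) \<Rightarrow>\<^sub>0 int) set monoid" where
  "moment_group k V b v = tensor_group (minor_space (k + 1)) (codim_one_group k V b v)"

definition rho ::
  "nat \<Rightarrow> 'n::{finite,linorder} rvec set set \<Rightarrow> ('n rvec set \<Rightarrow> nat) \<Rightarrow>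
   ('n rvec set \<Rightarrow> 'n rvec list) \<Rightarrow>
   ('n rvec set \<Rightarrow> 'n rvec set \<Rightarrow> 'n rvec) \<Rightarrow> ('n rvec set \<Rightarrow> 'n rvec) \<Rightarrow>
   'n rvec \<Rightarrow> 'n rvec set \<Rightarrow>
   ((('n set \<Rightarrow> real) \<times> ('n rvec set \<Rightarrow>\<^sub>0 int) set) \<Rightarrow>\<^sub>0 int) set" where
  "rho k V w b v p A F =
     pure_tensor (minor_space (k + 1)) (codim_one_group k V b v)
       (\<lambda>J. real (w F) * moment_vector A (p F) (b F) J) (face_element k V b v F)"

end

(*
  Bounded faces contribute nothing, because their chains vanish in the group of codimension-one
  faces, so one may sum over all maximal faces.  Expanding the chains and collecting the terms of a
  single codimension-one face G leaves the tensor of [G] with the sum over F containing G of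
  w(F) s_G(F) r_A(F).  The point on F may be taken on G, and s_G(F) turns the basis of F into the
  basis of G followed by v_G(F), so this sum is the cross product of AB, the basis of G, and the sum
  of the w(F) v_G(F), which is zero by the balancing condition.
*)

theory Submission
  imports Defs
begin

subsection \<open>Presented groups and tensor products\<close>

text \<open>The balancing identity is one between determinants, while \<open>lattice_basis\<close>
  speaks only of integer points. Two facts about lattices bridge the gap. The polyhedra are
  rational, so the integer points of a face span its direction space; hence a lattice basis has as
  many vectors as the dimension, and the base point may move within the face. Lists of equal length
  that generate the same lattice, one of them a basis, differ by an integral matrix of determinant 1
  or -1; thus \<open>orientation_sign\<close>, which a priori records only a sign, is the whole
  determinant, and no volume factor disturbs the weights. On the algebraic side the sign arises in
  the right tensor factor, as a coefficient of G, and has to move to the left one, where the minors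
  are added up; a tensor product over the integers permits this.\<close>

lemma (in comm_monoid) finprod_swap:
  assumes "finite A" "finite B" "\<And>a b. a \<in> A \<Longrightarrow> b \<in> B \<Longrightarrow> f a b \<in> carrier G"
  shows "(\<Otimes>a\<in>A. \<Otimes>b\<in>B. f a b) = (\<Otimes>b\<in>B. \<Otimes>a\<in>A. f a b)"
  using assms(1,3)
proof (induction A rule: finite_induct)
  case (insert a A)
  have "(\<Otimes>b\<in>B. \<Otimes>a\<in>insert a A. f a b) = (\<Otimes>b\<in>B. f a b \<otimes> (\<Otimes>a\<in>A. f a b))"
    using insert by (intro finprod_cong') (auto simp: Pi_iff)
  also have "\<dots> = (\<Otimes>b\<in>B. f a b) \<otimes> (\<Otimes>b\<in>B. \<Otimes>a\<in>A. f a b)"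
    using insert by (intro finprod_multf) (auto simp: Pi_iff)
  finally show ?case
    using insert by (subst finprod_insert) (auto simp: Pi_iff)
qed simp

lemma hom_finprod:
  assumes "comm_group G" "comm_group H" "h \<in> hom G H" "\<And>x. x \<in> A \<Longrightarrow> f x \<in> carrier G"
  shows "h (finprod G f A) = finprod H (\<lambda>x. h (f x)) A"
proof -
  interpret G: comm_group G by fact
  interpret H: comm_group H by fact
  have one: "h \<one>\<^bsub>G\<^esub> = \<one>\<^bsub>H\<^esub>"
    using assms(3) by (intro hom_one) auto
  have closed: "h x \<in> carrier H" if "x \<in> carrier G" for x
    using assms(3) that by (auto simp: hom_def)
  show ?thesis
    using assms(4)
  proof (induction A rule: infinite_finite_induct)
    case (insert x A)
    then show ?case
      using closed hom_mult[OF assms(3)] by (auto simp: Pi_iff)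
  qed (simp_all add: one)
qed

text \<open>The bridge from \<open>face_chain\<close>, a sum in the type of finitely supported
  functions, to a product in the group, the form to which \<open>hom_finprod\<close>
  applies.\<close>

lemma finprod_free_Abelian_group:
  assumes "\<And>x. x \<in> A \<Longrightarrow> Poly_Mapping.keys (f x) \<subseteq> S"
  shows "finprod (free_Abelian_group S) f A = (\<Sum>x\<in>A. f x)"
proof -
  interpret comm_group "free_Abelian_group S"
    by (rule abelian_free_Abelian_group)
  show ?thesis
    using assms by (induction A rule: infinite_finite_induct) (auto simp: Pi_iff)
qed

lemma presented_relations_subgroup:
  assumes "R \<subseteq> carrier (free_Abelian_group S)"
  shows "subgroup (presented_relations S R) (free_Abelian_group S)"
  unfolding presented_relations_def using assms by (intro group.generate_is_subgroup) auto

lemma comm_group_presented_group: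
  assumes "R \<subseteq> carrier (free_Abelian_group S)"
  shows "comm_group (presented_group S R)"
  unfolding presented_group_def
  by (intro comm_group.abelian_FactGroup abelian_free_Abelian_group
      presented_relations_subgroup assms)

lemma presented_class_hom:
  assumes "R \<subseteq> carrier (free_Abelian_group S)"
  shows "presented_class S R \<in> hom (free_Abelian_group S) (presented_group S R)"
proof -
  have "presented_relations S R \<lhd> free_Abelian_group S"
    by (intro comm_group.subgroup_imp_normal abelian_free_Abelian_group
      presented_relations_subgroup assms)
  then show ?thesis
    unfolding presented_group_def presented_class_def by (rule normal.r_coset_hom_Mod)
qed

lemma presented_class_relation:
  assumes "R \<subseteq> carrier (free_Abelian_group S)" "r \<in> R"
  shows "presented_class S R r = \<one>\<^bsub>presented_group S R\<^esub>"
proof -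
  have "r \<in> presented_relations S R"
    unfolding presented_relations_def using assms(2) by (rule generate.incl)
  then show ?thesis
    unfolding presented_group_def presented_class_def
    by (simp add: subgroup.rcos_const[OF presented_relations_subgroup[OF assms(1)]])
qed

lemma bilinear_relations_carrier:
  fixes A :: "('a, 'm) monoid_scheme" and B :: "('b, 'l) monoid_scheme"
  assumes "Group.monoid A" "Group.monoid B"
  shows "bilinear_relations A B \<subseteq> carrier (free_Abelian_group (carrier A \<times> carrier B))"
proof -
  have key: "frag_of x - frag_of y - frag_of z \<in> carrier (free_Abelian_group S)"
    if "x \<in> S" "y \<in> S" "z \<in> S" for x y z :: "'a \<times> 'b" and S
    using that keys_diff[of "frag_of x - frag_of y" "frag_of z"] keys_diff[of "frag_of x" "frag_of y"]
    by auto
  show ?thesis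
    unfolding bilinear_relations_def
    by (auto simp del: carrier_free_Abelian_group_iff
        intro!: key monoid.m_closed[OF assms(1)] monoid.m_closed[OF assms(2)])
qed

lemma comm_group_tensor_group:
  assumes "Group.monoid A" "Group.monoid B"
  shows "comm_group (tensor_group A B)"
  unfolding tensor_group_def by (intro comm_group_presented_group bilinear_relations_carrier assms)

lemma pure_tensor_closed:
  assumes "Group.monoid A" "Group.monoid B" "a \<in> carrier A" "b \<in> carrier B"
  shows "pure_tensor A B a b \<in> carrier (tensor_group A B)"
  using hom_in_carrier[OF presented_class_hom[OF bilinear_relations_carrier[OF assms(1,2)]]] assms(3,4)
  unfolding pure_tensor_def tensor_group_def by auto

text \<open>Both families in \<open>bilinear_relations\<close> have the shape x - y - z, so
  additivity of \<open>pure_tensor\<close> in either argument is an instance. The class of x is that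
  of (x - y - z) + (y + z), and the first summand is a relation.\<close>

lemma presented_class_add_eq:
  assumes R: "R \<subseteq> carrier (free_Abelian_group S)" and "x - y - z \<in> R"
    and yz: "Poly_Mapping.keys y \<subseteq> S" "Poly_Mapping.keys z \<subseteq> S"
  shows "presented_class S R x = presented_class S R y \<otimes>\<^bsub>presented_group S R\<^esub> presented_class S R z"
proof -
  interpret P: comm_group "presented_group S R"
    by (rule comm_group_presented_group[OF R])
  note h = presented_class_hom[OF R]
  have add: "presented_class S R (s + t)
      = presented_class S R s \<otimes>\<^bsub>presented_group S R\<^esub> presented_class S R t"
    if "Poly_Mapping.keys s \<subseteq> S" "Poly_Mapping.keys t \<subseteq> S" for s t
    using hom_mult[OF h, of s t] that by simp
  have k: "Poly_Mapping.keys (x - y - z) \<subseteq> S" "Poly_Mapping.keys (y + z) \<subseteq> S"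
    using subsetD[OF R assms(2)] yz keys_add[of y z] by auto
  have "presented_class S R x = presented_class S R ((x - y - z) + (y + z))"
    by simp
  also have "\<dots> = presented_class S R (y + z)"
    using k hom_in_carrier[OF h, of "y + z"]
    by (subst add) (auto simp: presented_class_relation[OF R assms(2)])
  also have "\<dots> = presented_class S R y \<otimes>\<^bsub>presented_group S R\<^esub> presented_class S R z"
    using yz by (rule add)
  finally show ?thesis .
qed

lemma pure_tensor_hom_left:
  assumes "Group.monoid A" "Group.monoid B" "b \<in> carrier B"
  shows "(\<lambda>a. pure_tensor A B a b) \<in> hom A (tensor_group A B)"
proof (rule homI)
  fix a a' assume a: "a \<in> carrier A" "a' \<in> carrier A"
  then show "pure_tensor A B a b \<in> carrier (tensor_group A B)"
    by (intro pure_tensor_closed assms)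
  have "frag_of (a \<otimes>\<^bsub>A\<^esub> a', b) - frag_of (a, b) - frag_of (a', b) \<in> bilinear_relations A B"
    unfolding bilinear_relations_def using a assms(3) by blast
  then show "pure_tensor A B (a \<otimes>\<^bsub>A\<^esub> a') b
      = pure_tensor A B a b \<otimes>\<^bsub>tensor_group A B\<^esub> pure_tensor A B a' b"
    unfolding pure_tensor_def tensor_group_def using a assms
    by (intro presented_class_add_eq bilinear_relations_carrier) auto
qed

lemma pure_tensor_hom_right:
  assumes "Group.monoid A" "Group.monoid B" "a \<in> carrier A"
  shows "pure_tensor A B a \<in> hom B (tensor_group A B)"
proof (rule homI)
  fix b b' assume b: "b \<in> carrier B" "b' \<in> carrier B"
  then show "pure_tensor A B a b \<in> carrier (tensor_group A B)"
    by (intro pure_tensor_closed assms)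
  have "frag_of (a, b \<otimes>\<^bsub>B\<^esub> b') - frag_of (a, b) - frag_of (a, b') \<in> bilinear_relations A B"
    unfolding bilinear_relations_def using b assms(3) by blast
  then show "pure_tensor A B a (b \<otimes>\<^bsub>B\<^esub> b')
      = pure_tensor A B a b \<otimes>\<^bsub>tensor_group A B\<^esub> pure_tensor A B a b'"
    unfolding pure_tensor_def tensor_group_def using b assms
    by (intro presented_class_add_eq bilinear_relations_carrier) auto
qed

lemma minor_space_simps [simp]:
  "f \<in> carrier (minor_space j) \<longleftrightarrow> (\<forall>J. card J \<noteq> j \<longrightarrow> f J = 0)"
  "f \<otimes>\<^bsub>minor_space j\<^esub> g = (\<lambda>J. f J + g J)"
  "\<one>\<^bsub>minor_space j\<^esub> = (\<lambda>_. 0)"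
  by (simp_all add: minor_space_def)

lemma comm_group_minor_space: "comm_group (minor_space j)"
proof (rule comm_groupI)
  fix f assume "f \<in> carrier (minor_space j)"
  then show "\<exists>g\<in>carrier (minor_space j). g \<otimes>\<^bsub>minor_space j\<^esub> f = \<one>\<^bsub>minor_space j\<^esub>"
    by (intro bexI[of _ "\<lambda>J. - f J"]) auto
qed (auto simp: algebra_simps)

lemma finprod_minor_space:
  assumes "\<And>x. x \<in> A \<Longrightarrow> f x \<in> carrier (minor_space j)"
  shows "finprod (minor_space j) f A = (\<lambda>J. \<Sum>x\<in>A. f x J)"
proof -
  interpret comm_group "minor_space j"
    by (rule comm_group_minor_space)
  show ?thesis
    using assms by (induction A rule: infinite_finite_induct) (auto simp: Pi_iff)
qed

text \<open>For s = -1 both sides are inverse to the tensor of \<open>a\<close> with the class of x: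
  the left one by additivity in the second factor, the right one by additivity in the first.
  Inverses in a group are unique.\<close>

lemma pure_tensor_sign:
  assumes "comm_group B" "a \<in> carrier (minor_space j)" "h \<in> hom (free_Abelian_group S) B"
    and "x \<in> S" "\<bar>s\<bar> = (1::int)"
  shows "pure_tensor (minor_space j) B a (h (frag_cmul s (frag_of x)))
       = pure_tensor (minor_space j) B (\<lambda>J. of_int s * a J) (h (frag_of x))"
proof (cases "s = 1")
  case False
  interpret A: comm_group "minor_space j"
    by (rule comm_group_minor_space)
  interpret B: comm_group B by fact
  note mon = A.monoid_axioms B.monoid_axioms
  interpret T: comm_group "tensor_group (minor_space j) B"
    by (rule comm_group_tensor_group[OF mon])
  let ?T = "pure_tensor (minor_space j) B"
  have s: "s = - 1"
    using False assms(5) by linarith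
  have hx: "h (frag_of x) \<in> carrier B" "h (- frag_of x) \<in> carrier B"
    using hom_in_carrier[OF assms(3)] assms(4) by auto
  have neg: "(\<lambda>J. - a J) \<in> carrier (minor_space j)"
    using assms(2) by auto
  interpret L: group_hom "minor_space j" "tensor_group (minor_space j) B"
      "\<lambda>a. ?T a (h (frag_of x))"
    using pure_tensor_hom_left[OF mon hx(1)]
    by (auto simp: group_hom_def group_hom_axioms_def A.group_axioms T.group_axioms)
  interpret R: group_hom B "tensor_group (minor_space j) B" "?T a"
    using pure_tensor_hom_right[OF mon assms(2)]
    by (auto simp: group_hom_def group_hom_axioms_def B.group_axioms T.group_axioms)
  have "h (- frag_of x) \<otimes>\<^bsub>B\<^esub> h (frag_of x) = \<one>\<^bsub>B\<^esub>"
    using hom_mult[OF assms(3), of "- frag_of x" "frag_of x"] assms(4)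
      hom_one[OF assms(3) group_free_Abelian_group B.group_axioms] by simp
  then have "?T a (h (- frag_of x)) \<otimes>\<^bsub>tensor_group (minor_space j) B\<^esub> ?T a (h (frag_of x))
      = \<one>\<^bsub>tensor_group (minor_space j) B\<^esub>"
    using R.hom_mult[OF hx(2,1)] R.hom_one by simp
  moreover have "?T (\<lambda>J. - a J) (h (frag_of x)) \<otimes>\<^bsub>tensor_group (minor_space j) B\<^esub> ?T a (h (frag_of x))
      = \<one>\<^bsub>tensor_group (minor_space j) B\<^esub>"
    using L.hom_mult[OF neg assms(2), symmetric] L.hom_one by simp
  moreover note L.hom_closed[OF neg] L.hom_closed[OF assms(2)] R.hom_closed[OF hx(2)]
  ultimately have "?T a (h (- frag_of x)) = ?T (\<lambda>J. - a J) (h (frag_of x))"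
    by (metis T.inv_equality)
  then show ?thesis
    by (simp add: s)
qed simp

subsection \<open>Minors and transition matrices\<close>

text \<open>For a fixed set J of columns the minor of \<open>bs\<close> is the determinant of a
  product of matrices. The transpose enters because the vectors are rows of the minor matrix while
  their coefficients are columns of \<open>N\<close>.\<close>

lemma generalized_cross_base_change:
  assumes N: "N \<in> carrier_mat m m" and len: "length cs = m" "length bs = m"
    and bs: "\<And>j. j < m \<Longrightarrow> bs ! j = (\<Sum>i<m. N $$ (i, j) *\<^sub>R (cs ! i))"
  shows "generalized_cross bs J = Determinant.det N * generalized_cross cs J"
proof -
  let ?col = "\<lambda>c. sorted_list_of_set J ! c"
  let ?C = "mat m m (\<lambda>(r, c). (cs ! r) $ ?col c)" and ?B = "mat m m (\<lambda>(r, c). (bs ! r) $ ?col c)"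
  have "?B = transpose_mat N * ?C"
  proof (rule eq_matI)
    fix r c assume "r < dim_row (transpose_mat N * ?C)" "c < dim_col (transpose_mat N * ?C)"
    then have rc: "r < m" "c < m" using N by auto
    then show "?B $$ (r, c) = (transpose_mat N * ?C) $$ (r, c)"
      using N by (simp add: bs scalar_prod_def sum_component atLeast0LessThan)
  qed (use N in auto)
  then have "Determinant.det ?B = Determinant.det N * Determinant.det ?C"
    using N by (simp add: Determinant.det_mult[where n = m] Determinant.det_transpose)
  then show ?thesis
    by (simp add: generalized_cross_def len)
qed

text \<open>Laplace expansion along the last row, whose cofactors do not see that row.\<close>

lemma linear_generalized_cross_last: "linear (\<lambda>v. generalized_cross (vs @ [v]) J)"
proof (cases "card J = Suc (length vs)")
  case True
  let ?m = "Suc (length vs)"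
  let ?M = "\<lambda>v. mat ?m ?m (\<lambda>(r, c). ((vs @ [v]) ! r) $ (sorted_list_of_set J ! c))"
  \<comment> \<open>The cofactors are computed with 0 as last row; deleting that row makes the
    choice irrelevant.\<close>
  define K where "K = (\<lambda>c. cofactor (?M 0) (length vs) c)"
  have cof: "cofactor (?M v) (length vs) c = K c" for v c
  proof -
    have "mat_delete (?M v) (length vs) c = mat_delete (?M 0) (length vs) c"
      by (rule eq_matI) (auto simp: mat_delete_def nth_append)
    then show ?thesis
      by (simp add: cofactor_def K_def)
  qed
  have "generalized_cross (vs @ [v]) J
      = (\<Sum>c<?m. v $ (sorted_list_of_set J ! c) * K c)" for v
  proof -
    have "generalized_cross (vs @ [v]) J = Determinant.det (?M v)"
      using True by (simp add: generalized_cross_def)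
    also have "\<dots> = (\<Sum>c<?m. ?M v $$ (length vs, c) * cofactor (?M v) (length vs) c)"
      by (rule laplace_expansion_row) auto
    finally show ?thesis
      by (simp only: cof) simp
  qed
  then show ?thesis
    by (intro linearI) (simp_all add: distrib_right sum.distrib sum_distrib_left mult.assoc del: sum.lessThan_Suc)
next
  case False
  then show ?thesis
    by (simp add: generalized_cross_def linear_iff)
qed

text \<open>By linearity in the last vector it suffices to take a member of \<open>vs\<close>, and
  then two rows coincide.\<close>

lemma generalized_cross_last_in_span:
  assumes "v \<in> span (set vs)"
  shows "generalized_cross (vs @ [v]) J = 0"
proof (rule linear_eq_0_on_span[OF linear_generalized_cross_last _ assms])
  fix x assume "x \<in> set vs"
  then obtain i where i: "i < length vs" "vs ! i = x"
    by (auto simp: in_set_conv_nth)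
  let ?m = "Suc (length vs)"
  have "Determinant.det (mat ?m ?m (\<lambda>(r, c). ((vs @ [x]) ! r) $ (sorted_list_of_set J ! c))) = 0"
    by (rule Determinant.det_identical_rows[of _ ?m i "length vs"])
      (use i in \<open>auto simp: nth_append intro!: eq_vecI\<close>)
  then show "generalized_cross (vs @ [x]) J = 0"
    by (simp add: generalized_cross_def)
qed

text \<open>Coefficients are indexed by positions instead of vectors, so that they can serve as
  matrix entries.\<close>

lemma in_span_list_coeffs:
  fixes cs :: "'a::real_vector list"
  assumes "x \<in> span (set cs)"
  obtains c where "x = (\<Sum>i<length cs. c i *\<^sub>R (cs ! i))"
proof -
  have "\<exists>c. x = (\<Sum>i<length cs. c i *\<^sub>R (cs ! i))"
    using assms
  proof (induction rule: span_induct_alt)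
    case base
    show ?case by (intro exI[of _ "\<lambda>_. 0"]) simp
  next
    case (step a y z)
    then obtain c j where c: "z = (\<Sum>i<length cs. c i *\<^sub>R (cs ! i))" "j < length cs" "cs ! j = y"
      by (auto simp: in_set_conv_nth)
    have "a *\<^sub>R y = (\<Sum>i<length cs. (if i = j then a else 0) *\<^sub>R (cs ! i))"
      using c by (simp add: if_distrib[of "\<lambda>t. t *\<^sub>R _"] sum.delta cong: if_cong)
    then have "a *\<^sub>R y + z = (\<Sum>i<length cs. ((if i = j then a else 0) + c i) *\<^sub>R (cs ! i))"
      using c by (simp add: scaleR_add_left sum.distrib)
    then show ?case
      by (intro exI[of _ "\<lambda>i. (if i = j then a else 0) + c i"])
  qed
  then show thesis using that by blast
qed

lemma in_group_closure_list_coeffs: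
  fixes cs :: "'a::real_vector list"
  assumes "x \<in> group_closure (set cs)"
  obtains c where "\<And>i. c i \<in> \<int>" "x = (\<Sum>i<length cs. c i *\<^sub>R (cs ! i))"
proof -
  have "\<exists>c. (\<forall>i. c i \<in> \<int>) \<and> x = (\<Sum>i<length cs. c i *\<^sub>R (cs ! i))"
    using assms
  proof (induction rule: group_closure.induct)
    case (base s)
    show ?case
    proof (cases "s = 0")
      case True
      then show ?thesis by (intro exI[of _ "\<lambda>_. 0"]) simp
    next
      case False
      with base obtain j where j: "j < length cs" "cs ! j = s"
        by (auto simp: in_set_conv_nth)
      then show ?thesis
        by (intro exI[of _ "\<lambda>i. if i = j then 1 else 0"])
          (simp add: if_distrib[of "\<lambda>t. t *\<^sub>R _"] sum.delta cong: if_cong)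
    qed
  next
    case (diff s t)
    then obtain c d where "\<forall>i. c i \<in> \<int>" "s = (\<Sum>i<length cs. c i *\<^sub>R (cs ! i))"
      "\<forall>i. d i \<in> \<int>" "t = (\<Sum>i<length cs. d i *\<^sub>R (cs ! i))"
      by blast
    then show ?case
      by (intro exI[of _ "\<lambda>i. c i - d i"]) (simp add: scaleR_diff_left sum_subtractf)
  qed
  then show thesis using that by blast
qed

text \<open>The map \<open>pos\<close> sends a vector back to its position, which turns a sum over
  positions into the sum over a set that \<open>independentD\<close> expects.\<close>

lemma independent_list_coeffs_unique:
  fixes cs :: "'a::real_vector list"
  assumes "distinct cs" "independent (set cs)"
    and "(\<Sum>i<length cs. c i *\<^sub>R (cs ! i)) = (\<Sum>i<length cs. d i *\<^sub>R (cs ! i))" "j < length cs"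
  shows "c j = d j"
proof -
  define pos where "pos = the_inv_into {..<length cs} ((!) cs)"
  have inj: "inj_on ((!) cs) {..<length cs}"
    using assms(1) by (auto simp: inj_on_def nth_eq_iff_index_eq)
  have img: "(!) cs ` {..<length cs} = set cs"
    by (auto simp: set_conv_nth)
  have pos: "pos (cs ! i) = i" if "i < length cs" for i
    unfolding pos_def using inj that by (simp add: the_inv_into_f_f)
  have "(\<Sum>x\<in>set cs. (c (pos x) - d (pos x)) *\<^sub>R x) = (\<Sum>i<length cs. (c i - d i) *\<^sub>R (cs ! i))"
    unfolding img[symmetric] by (subst sum.reindex[OF inj]) (auto simp: pos intro!: sum.cong)
  also have "\<dots> = 0"
    using assms(3) by (simp add: scaleR_diff_left sum_subtractf)
  finally have "c (pos (cs ! j)) - d (pos (cs ! j)) = 0"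
    using assms(4)
    by (intro independentD[OF assms(2) finite_set subset_refl,
          where u = "\<lambda>x. c (pos x) - d (pos x)"]) auto
  then show ?thesis
    using pos[OF assms(4)] by simp
qed

lemma det_in_Ints:
  assumes "M \<in> carrier_mat m m" "\<And>i j. i < m \<Longrightarrow> j < m \<Longrightarrow> M $$ (i, j) \<in> (\<int> :: real set)"
  shows "Determinant.det M \<in> \<int>"
  unfolding Determinant.det_def'[OF assms(1)]
proof (intro Ints_sum Ints_mult Ints_prod assms(2))
  fix p assume "p \<in> {p. p permutes {0..<m}}"
  show "signof p \<in> (\<int> :: real set)"
    by (auto simp: sign_def)
next
  fix p i assume "p \<in> {p. p permutes {0..<m}}" "i \<in> {0..<m}"
  then show "i < m" "p i < m"
    using permutes_in_image[of p "{0..<m}" i] by auto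
qed

text \<open>The transition matrix and its inverse are integral, so the determinant is a unit of \<open>\<int>\<close>.\<close>

lemma transition_matrix_det:
  fixes bs cs :: "'a::real_vector list"
  assumes len: "length bs = length cs" and closure: "group_closure (set bs) = group_closure (set cs)"
    and cs: "distinct cs" "independent (set cs)"
  obtains M where "M \<in> carrier_mat (length cs) (length cs)"
    "\<And>j. j < length cs \<Longrightarrow> bs ! j = (\<Sum>i<length cs. M $$ (i, j) *\<^sub>R (cs ! i))"
    "\<bar>Determinant.det M\<bar> = 1"
proof -
  let ?m = "length cs"
  have mat: "\<exists>M \<in> carrier_mat ?m ?m. (\<forall>i<?m. \<forall>j<?m. M $$ (i, j) \<in> \<int>) \<and>
      (\<forall>j<?m. xs ! j = (\<Sum>i<?m. M $$ (i, j) *\<^sub>R (ys ! i)))"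
    if xs: "length xs = ?m" "length ys = ?m" "group_closure (set xs) = group_closure (set ys)"
    for xs ys :: "'a list"
  proof -
    have "\<exists>c. (\<forall>i. c i \<in> \<int>) \<and> xs ! j = (\<Sum>i<?m. c i *\<^sub>R (ys ! i))" if j: "j < ?m" for j
    proof -
      have "xs ! j \<in> group_closure (set ys)"
        unfolding xs(3)[symmetric] using j xs(1) by (intro group_closure.base) simp
      then show ?thesis
        by (rule in_group_closure_list_coeffs) (use xs(2) in auto)
    qed
    then have "\<forall>j\<in>{..<?m}. \<exists>c. (\<forall>i. c i \<in> \<int>) \<and> xs ! j = (\<Sum>i<?m. c i *\<^sub>R (ys ! i))"
      by simp
    then obtain c where "\<forall>j\<in>{..<?m}. (\<forall>i. c j i \<in> \<int>) \<and> xs ! j = (\<Sum>i<?m. c j i *\<^sub>R (ys ! i))"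
      by (drule_tac bchoice) (elim exE)
    then show ?thesis
      by (intro bexI[of _ "mat ?m ?m (\<lambda>(i, j). c j i)"]) auto
  qed
  obtain M where M: "M \<in> carrier_mat ?m ?m" "\<And>i j. i < ?m \<Longrightarrow> j < ?m \<Longrightarrow> M $$ (i, j) \<in> \<int>"
    "\<And>j. j < ?m \<Longrightarrow> bs ! j = (\<Sum>i<?m. M $$ (i, j) *\<^sub>R (cs ! i))"
    using mat[of bs cs] len closure by blast
  obtain N where N: "N \<in> carrier_mat ?m ?m" "\<And>i j. i < ?m \<Longrightarrow> j < ?m \<Longrightarrow> N $$ (i, j) \<in> \<int>"
    "\<And>j. j < ?m \<Longrightarrow> cs ! j = (\<Sum>i<?m. N $$ (i, j) *\<^sub>R (bs ! i))"
    using mat[of cs bs] len closure by fastforce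
  \<comment> \<open>Each vector of \<open>cs\<close> is expanded over \<open>bs\<close> and back
    over \<open>cs\<close>; independence of \<open>cs\<close> allows the coefficients to be
    compared.\<close>
  have "M * N = 1\<^sub>m ?m"
  proof (rule eq_matI)
    fix i j assume "i < dim_row (1\<^sub>m ?m :: real mat)" "j < dim_col (1\<^sub>m ?m :: real mat)"
    then have ij: "i < ?m" "j < ?m" by auto
    have "(\<Sum>i<?m. (if i = j then 1 else 0) *\<^sub>R (cs ! i)) = cs ! j"
      using ij by (simp add: if_distrib[of "\<lambda>t. t *\<^sub>R _"] sum.delta cong: if_cong)
    also have "\<dots> = (\<Sum>l<?m. N $$ (l, j) *\<^sub>R (bs ! l))"
      using ij(2) by (rule N(3))
    also have "\<dots> = (\<Sum>l<?m. \<Sum>i<?m. (N $$ (l, j) * M $$ (i, l)) *\<^sub>R (cs ! i))"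
      by (intro sum.cong refl) (simp add: M(3) scaleR_sum_right)
    also have "\<dots> = (\<Sum>i<?m. (\<Sum>l<?m. M $$ (i, l) * N $$ (l, j)) *\<^sub>R (cs ! i))"
      by (subst sum.swap) (simp add: scaleR_sum_left mult.commute)
    finally have "(if i = j then 1 else 0) = (\<Sum>l<?m. M $$ (i, l) * N $$ (l, j))"
      by (rule independent_list_coeffs_unique[OF cs _ ij(1)])
    then show "(M * N) $$ (i, j) = 1\<^sub>m ?m $$ (i, j)"
      using M(1) N(1) ij by (simp add: scalar_prod_def atLeast0LessThan)
  qed (use M(1) N(1) in auto)
  then have "Determinant.det M * Determinant.det N = 1"
    using Determinant.det_mult[OF M(1) N(1)] by simp
  moreover obtain x y where "Determinant.det M = of_int x" "Determinant.det N = of_int y"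
    using det_in_Ints[OF M(1,2)] det_in_Ints[OF N(1,2)] by (auto simp: Ints_def)
  ultimately have "real_of_int (x * y) = 1"
    by simp
  then have "x * y = 1"
    by (simp only: of_int_eq_1_iff)
  then have "\<bar>x\<bar> = 1"
    using abs_zmult_eq_1[of x y] by simp
  then show thesis
    using that[OF M(1,3)] \<open>Determinant.det M = of_int x\<close> by simp
qed

text \<open>\<open>same_orientation\<close> asks for some transition matrix with positive
  determinant. Independence of \<open>cs\<close> leaves only one transition matrix, so a negative
  determinant refutes it.\<close>

lemma same_orientation_iff_det:
  assumes "distinct cs" "independent (set cs)" "length bs = length cs"
    and "M \<in> carrier_mat (length cs) (length cs)"
    and "\<And>j. j < length cs \<Longrightarrow> bs ! j = (\<Sum>i<length cs. M $$ (i, j) *\<^sub>R (cs ! i))"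
  shows "same_orientation bs cs \<longleftrightarrow> 0 < Determinant.det M"
proof -
  have "N = M" if N: "N \<in> carrier_mat (length cs) (length cs)"
    "\<forall>j<length cs. bs ! j = (\<Sum>i<length cs. N $$ (i, j) *\<^sub>R (cs ! i))" for N
  proof (rule eq_matI)
    fix i j assume "i < dim_row M" "j < dim_col M"
    then have "i < length cs" "j < length cs" using assms(4) by auto
    then show "N $$ (i, j) = M $$ (i, j)"
      using N(2) assms(5) independent_list_coeffs_unique[OF assms(1,2), of "\<lambda>i. N $$ (i, j)" "\<lambda>i. M $$ (i, j)" i]
      by simp
  qed (use N assms(4) in auto)
  then show ?thesis
    unfolding same_orientation_def using assms(3-5) by auto
qed

text \<open>Moving the base point and changing the basis are one base change: with x = y +
  (combination of \<open>cs\<close>), the transition matrix is block lower triangular with diagonal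
  blocks 1 and \<open>M\<close>, so the shift does not affect the determinant. For
  \<open>bs = cs\<close> and \<open>M\<close> the identity this is the independence of the moment
  from the point chosen on F.\<close>

lemma generalized_cross_Cons_base_change:
  assumes M: "M \<in> carrier_mat (length cs) (length cs)" and len: "length bs = length cs"
    and bs: "\<And>j. j < length cs \<Longrightarrow> bs ! j = (\<Sum>i<length cs. M $$ (i, j) *\<^sub>R (cs ! i))"
    and xy: "x - y \<in> span (set cs)"
  shows "generalized_cross (x # bs) J = Determinant.det M * generalized_cross (y # cs) J"
proof -
  let ?m = "length cs"
  obtain c where c: "x - y = (\<Sum>i<?m. c i *\<^sub>R (cs ! i))"
    using in_span_list_coeffs[OF xy] .
  define C where "C = mat ?m 1 (\<lambda>(i, _). c i)"
  define N where "N = four_block_mat (1\<^sub>m 1) (0\<^sub>m 1 ?m) C M"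
  have N: "N \<in> carrier_mat (Suc ?m) (Suc ?m)"
    unfolding N_def using four_block_carrier_mat[of "1\<^sub>m 1" 1 1 M ?m ?m] M by simp
  have "generalized_cross (x # bs) J = Determinant.det N * generalized_cross (y # cs) J"
  proof (rule generalized_cross_base_change[OF N])
    fix j assume j: "j < Suc ?m"
    show "(x # bs) ! j = (\<Sum>i<Suc ?m. N $$ (i, j) *\<^sub>R ((y # cs) ! i))"
    proof (cases j)
      case 0
      have "x = y + (\<Sum>i<?m. c i *\<^sub>R (cs ! i))"
        using c by (simp add: algebra_simps)
      then show ?thesis
        using M 0 by (subst sum.lessThan_Suc_shift) (simp add: N_def C_def)
    next
      case (Suc l)
      then show ?thesis
        using M j by (subst sum.lessThan_Suc_shift) (simp add: N_def C_def bs)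
    qed
  qed (simp_all add: len)
  also have "Determinant.det N = Determinant.det M"
    unfolding N_def using M
    by (subst det_four_block_mat_upper_right_zero[where n = 1 and m = ?m]) (auto simp: C_def)
  finally show ?thesis .
qed

text \<open>The transition determinant is 1 or -1 and its sign decides the orientation, so it equals
  \<open>orientation_sign\<close>. In the application \<open>bs\<close> and \<open>cs\<close> are
  the bases of G and F, and x and y are the vectors from A to a point of G and to the chosen point
  of F.\<close>

lemma orientation_sign_cross:
  assumes "distinct cs" "independent (set cs)" "length cs = Suc (length bs)"
    and "group_closure (set (bs @ [v])) = group_closure (set cs)"
    and "x - y \<in> span (set cs)"
  shows "of_int (orientation_sign bs v cs) * generalized_cross (y # cs) J = generalized_cross (x # bs @ [v]) J"
proof -
  have len: "length (bs @ [v]) = length cs"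
    using assms(3) by simp
  obtain M where M: "M \<in> carrier_mat (length cs) (length cs)"
    "\<And>j. j < length cs \<Longrightarrow> (bs @ [v]) ! j = (\<Sum>i<length cs. M $$ (i, j) *\<^sub>R (cs ! i))"
    "\<bar>Determinant.det M\<bar> = 1"
    using transition_matrix_det[OF len assms(4,1,2)] by blast
  have "same_orientation (bs @ [v]) cs \<longleftrightarrow> 0 < Determinant.det M"
    by (rule same_orientation_iff_det[OF assms(1,2) len M(1,2)])
  then have "of_int (orientation_sign bs v cs) = Determinant.det M"
    unfolding orientation_sign_def using M(3) by auto
  then show ?thesis
    using generalized_cross_Cons_base_change[OF M(1) len M(2) assms(5)] by simp
qed

subsection \<open>Lattices of rational polyhedra\<close>

lemma direction_space_diff: "x \<in> S \<Longrightarrow> y \<in> S \<Longrightarrow> x - y \<in> direction_space S"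
  unfolding direction_space_def by (rule span_base) blast

lemma direction_space_eq_span:
  assumes "a \<in> S"
  shows "direction_space S = span ((+) (- a) ` S)"
proof
  have "x - y \<in> span ((+) (- a) ` S)" if "x \<in> S" "y \<in> S" for x y
  proof -
    have "(- a + x) - (- a + y) \<in> span ((+) (- a) ` S)"
      using that by (intro span_diff span_base imageI)
    then show ?thesis by simp
  qed
  then show "direction_space S \<subseteq> span ((+) (- a) ` S)"
    unfolding direction_space_def by (intro span_minimal subspace_span) blast
  show "span ((+) (- a) ` S) \<subseteq> direction_space S"
    unfolding direction_space_def using assms by (intro span_mono) force
qed

lemma dim_direction_space:
  assumes "S \<noteq> {}"
  shows "int (dim (direction_space S)) = aff_dim S"
proof -
  obtain a where a: "a \<in> S" using assms by blast
  then have "aff_dim S = int (dim ((+) (- a) ` S))"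
    by (intro aff_dim_eq_dim hull_inc)
  then show ?thesis
    by (simp add: direction_space_eq_span[OF a])
qed

text \<open>If a \<bullet> x is nonzero, this vector is the projection of y along x onto the kernel
  of a, multiplied by a \<bullet> x to clear the denominator.\<close>

lemma integer_vector_linear_image:
  assumes "integer_vector a" "integer_vector x" "integer_vector y"
  shows "integer_vector ((a \<bullet> x) *\<^sub>R y - (a \<bullet> y) *\<^sub>R x)"
proof -
  have "a \<bullet> z \<in> \<int>" if "integer_vector z" for z
    using that assms(1) unfolding integer_vector_def inner_vec_def by (auto intro!: Ints_sum Ints_mult)
  then show ?thesis
    using assms(2,3) by (auto simp: integer_vector_def intro!: Ints_diff Ints_mult)
qed

text \<open>
  Imposing one more equation \<open>a \<bullet> x = 0\<close> keeps a rational subspace rational, since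
  \<open>y \<mapsto> (a \<bullet> z) y - (a \<bullet> y) z\<close> maps it onto the smaller subspace and preserves integrality when
  \<open>z\<close> is integral with \<open>a \<bullet> z \<noteq> 0\<close>.
\<close>

lemma span_integer_kernel:
  fixes T :: "'n::finite rvec set"
  assumes "finite T" "\<And>a. a \<in> T \<Longrightarrow> integer_vector a"
  shows "{x. \<forall>a\<in>T. a \<bullet> x = 0} \<subseteq> span {x. (\<forall>a\<in>T. a \<bullet> x = 0) \<and> integer_vector x}"
  using assms
proof (induction T rule: finite_induct)
  case empty
  have "Basis \<subseteq> {x :: 'n rvec. integer_vector x}"
    by (auto simp: Basis_vec_def integer_vector_def axis_def)
  then have "span Basis \<subseteq> span {x :: 'n rvec. integer_vector x}"
    by (rule span_mono)
  then show ?case by simp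
next
  case (insert a T)
  define L where "L = {x. (\<forall>a\<in>T. a \<bullet> x = 0) \<and> integer_vector x}"
  define L' where "L' = {x. (\<forall>a\<in>insert a T. a \<bullet> x = 0) \<and> integer_vector x}"
  have a: "integer_vector a" using insert by simp
  have "x \<in> span L'" if x: "\<forall>a\<in>insert a T. a \<bullet> x = 0" for x
  \<comment> \<open>If no integral z with a \<bullet> z nonzero is available, the new equation
    already holds on \<open>L\<close>, and the induction hypothesis suffices.\<close>
  proof (cases "\<forall>y\<in>L. a \<bullet> y = 0")
    case True
    then have "L = L'" by (auto simp: L_def L'_def)
    then show ?thesis using insert x by (auto simp: L_def)
  next
    case False
    then obtain z where z: "z \<in> L" "a \<bullet> z \<noteq> 0" by blast
    let ?f = "\<lambda>y. (a \<bullet> z) *\<^sub>R y - (a \<bullet> y) *\<^sub>R z"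
    have lin: "linear ?f"
      by (intro linearI) (simp_all add: algebra_simps)
    have "?f ` L \<subseteq> L'"
    proof (rule image_subsetI)
      fix y assume y: "y \<in> L"
      have "integer_vector (?f y)"
        using a z y by (intro integer_vector_linear_image) (auto simp: L_def)
      then show "?f y \<in> L'"
        using y z by (auto simp: L_def L'_def inner_diff_right)
    qed
    moreover have "x \<in> span L"
      using insert x by (auto simp: L_def)
    then have "?f x \<in> ?f ` span L" by (rule imageI)
    then have "?f x \<in> span (?f ` L)"
      by (simp only: linear_span_image[OF lin])
    \<comment> \<open>As a \<bullet> x = 0, the map \<open>?f\<close> merely multiplies x by the
      nonzero number a \<bullet> z, which is then divided out.\<close>
    ultimately have "(a \<bullet> z) *\<^sub>R x \<in> span L'"
      using x span_mono[of "?f ` L" L'] by auto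
    then have "(1 / (a \<bullet> z)) *\<^sub>R ((a \<bullet> z) *\<^sub>R x) \<in> span L'"
      by (rule span_scale)
    then show ?thesis using z(2) by simp
  qed
  then show ?case unfolding L'_def by blast
qed

text \<open>The direction space is the common kernel of the normals whose inequality is an equality
  on all of S. These normals are integral, so \<open>span_integer_kernel\<close> applies.\<close>

lemma rational_polyhedron_direction_space:
  fixes S :: "'n::finite rvec set"
  assumes "rational_polyhedron S" "S \<noteq> {}"
  shows "span (face_integer_lattice S) = direction_space S"
proof
  show "span (face_integer_lattice S) \<subseteq> direction_space S"
    unfolding face_integer_lattice_def direction_space_def by (intro span_minimal) auto
  obtain H where H: "finite H" "S = \<Inter>H"
    "\<forall>h\<in>H. \<exists>a b. a \<noteq> 0 \<and> integer_vector a \<and> h = {x. a \<bullet> x \<le> b}"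
    using assms(1) unfolding rational_polyhedron_def by blast
  have "\<forall>h\<in>H. \<exists>ab. integer_vector (fst ab) \<and> h = {x. fst ab \<bullet> x \<le> snd ab}"
    using H(3) by force
  then obtain ab where "\<forall>h\<in>H. integer_vector (fst (ab h)) \<and> h = {x. fst (ab h) \<bullet> x \<le> snd (ab h)}"
    by (drule_tac bchoice) (elim exE)
  then obtain a b where ab: "\<And>h. h \<in> H \<Longrightarrow> integer_vector (a h)"
    "\<And>h. h \<in> H \<Longrightarrow> h = {x. a h \<bullet> x \<le> b h}"
    using that[of "fst \<circ> ab" "snd \<circ> ab"] by (simp add: o_def)
  have mem: "x \<in> S \<longleftrightarrow> (\<forall>h\<in>H. a h \<bullet> x \<le> b h)" for x
    using H(2) ab(2) by blast
  define T where "T = {h \<in> H. \<forall>x\<in>S. a h \<bullet> x = b h}"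
  have "convex S"
    unfolding H(2) using H(3) by (intro convex_Inter) (auto simp: convex_halfspace_le)
  then obtain y where y: "y \<in> rel_interior S"
    using assms(2) rel_interior_eq_empty by blast
  have yS: "y \<in> S" using y rel_interior_subset by blast
  \<comment> \<open>Some x in S satisfies the inequality strictly, and the segment from x can be
    prolonged beyond the relative interior point y inside S. Equality at y would make the prolonged
    point violate the inequality.\<close>
  have slack: "a h \<bullet> y < b h" if "h \<in> H - T" for h
  proof -
    obtain x where x: "x \<in> S" "a h \<bullet> x \<noteq> b h"
      using \<open>h \<in> H - T\<close> unfolding T_def by blast
    have "a h \<bullet> x < b h"
      using x mem that by force
    obtain m where m: "m > 1" "(1 - m) *\<^sub>R x + m *\<^sub>R y \<in> S"
      using convex_rel_interior_iff[OF \<open>convex S\<close> assms(2)] y x(1) by blast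
    have "(1 - m) * (a h \<bullet> x) + m * (a h \<bullet> y) \<le> b h"
      using m(2) mem that by (auto simp: inner_add_right)
    moreover have "(1 - m) * (a h \<bullet> x) > (1 - m) * b h"
      using \<open>a h \<bullet> x < b h\<close> m(1) by simp
    ultimately have "m * (a h \<bullet> y) < m * b h"
      by (simp add: algebra_simps)
    then show ?thesis using m(1) by simp
  qed
  have "x \<in> direction_space S" if x: "\<forall>c\<in>a ` T. c \<bullet> x = 0" for x
  proof -
    \<comment> \<open>From y a short step along x stays in S: equalities persist because x lies in
      the kernel, strict inequalities by continuity, and finiteness of \<open>H\<close> gives a
      common step length. So a positive multiple of x is a difference of two points of S.\<close>
    have "\<forall>h\<in>H. \<forall>\<^sub>F e in at_right 0. a h \<bullet> (y + e *\<^sub>R x) \<le> b h"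
    proof
      fix h assume h: "h \<in> H"
      show "\<forall>\<^sub>F e in at_right 0. a h \<bullet> (y + e *\<^sub>R x) \<le> b h"
      proof (cases "h \<in> T")
        case True
        then show ?thesis
          using x yS mem by (auto simp: inner_add_right T_def)
      next
        case False
        have "((\<lambda>e. a h \<bullet> (y + e *\<^sub>R x)) \<longlongrightarrow> a h \<bullet> (y + 0 *\<^sub>R x)) (at_right 0)"
          by (intro tendsto_intros)
        then have "\<forall>\<^sub>F e in at_right 0. a h \<bullet> (y + e *\<^sub>R x) < b h"
          using slack[of h] h False by (intro order_tendstoD(2)) auto
        then show ?thesis by (rule eventually_mono) simp
      qed
    qed
    then have "\<forall>\<^sub>F e in at_right 0. \<forall>h\<in>H. a h \<bullet> (y + e *\<^sub>R x) \<le> b h"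
      by (rule eventually_ball_finite[OF H(1)])
    then have "\<forall>\<^sub>F e in at_right (0::real). 0 < e \<and> y + e *\<^sub>R x \<in> S"
      using eventually_at_right_less[of "0::real"] by eventually_elim (simp add: mem)
    then obtain e :: real where e: "0 < e" "y + e *\<^sub>R x \<in> S"
      using eventually_happens[of _ "at_right (0::real)"] by auto
    have "e *\<^sub>R x \<in> direction_space S"
      using direction_space_diff[OF e(2) yS] by simp
    then have "(1 / e) *\<^sub>R (e *\<^sub>R x) \<in> direction_space S"
      unfolding direction_space_def by (rule span_scale)
    then show ?thesis using e(1) by simp
  qed
  then have kernel: "{x. \<forall>c\<in>a ` T. c \<bullet> x = 0} \<subseteq> direction_space S"
    by blast
  have "direction_space S \<subseteq> {x. \<forall>c\<in>a ` T. c \<bullet> x = 0}"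
    unfolding direction_space_def
  proof (rule span_minimal)
    show "subspace {x. \<forall>c\<in>a ` T. c \<bullet> x = 0}"
      by (auto simp: subspace_def inner_add_right)
  qed (auto simp: T_def inner_diff_right)
  also have "\<dots> \<subseteq> span {x. (\<forall>c\<in>a ` T. c \<bullet> x = 0) \<and> integer_vector x}"
    using H(1) ab(1) by (intro span_integer_kernel) (auto simp: T_def)
  also have "\<dots> \<subseteq> span (face_integer_lattice S)"
    unfolding face_integer_lattice_def using kernel by (intro span_mono) blast
  finally show "direction_space S \<subseteq> span (face_integer_lattice S)" .
qed

lemma group_closure_subset_span:
  fixes B :: "'a::real_vector set"
  shows "group_closure B \<subseteq> span B"
proof
  fix x assume "x \<in> group_closure B"
  then show "x \<in> span B"
    by induction (auto intro: span_base span_zero span_diff)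
qed

text \<open>\<open>primitive_vector\<close> adjoins v to the whole lattice of G; this replaces that
  lattice by the chosen basis.\<close>

lemma group_closure_insert_group_closure:
  fixes B :: "'a::ab_group_add set"
  shows "group_closure (insert v (group_closure B)) = group_closure (insert v B)"
proof (intro equalityI subsetI)
  fix x assume "x \<in> group_closure (insert v B)"
  then show "x \<in> group_closure (insert v (group_closure B))"
    by induction (auto intro: group_closure.intros)
next
  have mono: "x \<in> group_closure (insert v B)" if "x \<in> group_closure B" for x
    using that by induction (auto intro: group_closure.intros)
  fix x assume "x \<in> group_closure (insert v (group_closure B))"
  then show "x \<in> group_closure (insert v B)"
    by induction (auto intro: group_closure.intros mono)
qed

text \<open>A lattice basis generates only the integer points; it is rationality of S that makes
  these span every direction.\<close>

lemma lattice_basis_span: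
  assumes "lattice_basis S bs" "rational_polyhedron S" "S \<noteq> {}"
  shows "span (set bs) = direction_space S"
proof
  have eq: "group_closure (set bs) = face_integer_lattice S"
    using assms(1) by (simp add: lattice_basis_def)
  have "direction_space S = span (group_closure (set bs))"
    using rational_polyhedron_direction_space[OF assms(2,3)] eq by simp
  also have "\<dots> \<subseteq> span (set bs)"
    using group_closure_subset_span by (intro span_minimal) auto
  finally show "direction_space S \<subseteq> span (set bs)" .
  have "set bs \<subseteq> face_integer_lattice S"
    unfolding eq[symmetric] by (auto intro: group_closure.base)
  then show "span (set bs) \<subseteq> direction_space S"
    unfolding face_integer_lattice_def direction_space_def by (intro span_minimal) auto
qed

lemma lattice_basis_length:
  assumes "lattice_basis S bs" "rational_polyhedron S" "S \<noteq> {}"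
  shows "int (length bs) = aff_dim S"
proof -
  have "length bs = dim (span (set bs))"
    using assms(1) dim_eq_card_independent[of "set bs"]
    by (simp add: lattice_basis_def distinct_card)
  then show ?thesis
    using dim_direction_space[OF assms(3)] lattice_basis_span[OF assms] by simp
qed

subsection \<open>Moments\<close>

lemma balanced_moments:
  fixes V :: "'n::{finite,linorder} rvec set set"
  assumes trop: "tropical_variety k V w"
    and basis: "\<And>S. S \<in> maximal_faces k V \<union> codim_one_faces k V \<Longrightarrow> lattice_basis S (b S)"
    and prim: "\<And>F. F \<in> maximal_faces k V \<Longrightarrow> G \<subseteq> F \<Longrightarrow> primitive_vector G F (v F)"
    and p: "\<And>F. F \<in> maximal_faces k V \<Longrightarrow> p F \<in> F"
    and G: "G \<in> codim_one_faces k V"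
  shows "(\<Sum>F\<in>{F \<in> maximal_faces k V. G \<subseteq> F}.
      of_int (orientation_sign (b G) (v F) (b F)) * (real (w F) * moment_vector A (p F) (b F) J)) = 0"
proof -
  let ?star = "{F \<in> maximal_faces k V. G \<subseteq> F}"
  have poly: "rational_polyhedron S \<and> S \<noteq> {}" if "S \<in> faces_of_dim d V" for S d
    using trop that
    by (auto simp: tropical_variety_def rational_polyhedral_complex_def faces_of_dim_def)
  have spanG: "span (set (b G)) = direction_space G" and lenG: "int (length (b G)) = int k - 1"
    using lattice_basis_span[OF basis] lattice_basis_length[OF basis] poly G
    by (auto simp: faces_of_dim_def)
  \<comment> \<open>One point of G serves all F containing G, so the cross products share every
    vector except the last.\<close>
  obtain x where x: "x \<in> G"
    using poly[OF G] by blast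
  have flip: "of_int (orientation_sign (b G) (v F) (b F)) * moment_vector A (p F) (b F) J
      = generalized_cross ((x - A) # b G @ [v F]) J" if F: "F \<in> ?star" for F
  proof -
    have FV: "F \<in> maximal_faces k V" "G \<subseteq> F" using F by auto
    have bF: "lattice_basis F (b F)" using basis FV by blast
    have "int (length (b F)) = int k"
      using lattice_basis_length[OF bF] poly[OF FV(1)] FV(1) by (simp add: faces_of_dim_def)
    then have len: "length (b F) = Suc (length (b G))"
      using lenG by simp
    have latG: "group_closure (set (b G)) = face_integer_lattice G"
      using basis[of G] G by (simp add: lattice_basis_def)
    have "group_closure (set (b G @ [v F])) = group_closure (insert (v F) (face_integer_lattice G))"
      by (simp add: group_closure_insert_group_closure latG[symmetric])
    also have "\<dots> = group_closure (set (b F))"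
      using prim[OF FV] bF by (simp add: primitive_vector_def lattice_basis_def)
    finally have closure: "group_closure (set (b G @ [v F])) = group_closure (set (b F))" .
    have "x - p F \<in> direction_space F"
      using x FV p[OF FV(1)] by (intro direction_space_diff) auto
    then have "(x - A) - (p F - A) \<in> span (set (b F))"
      using lattice_basis_span[OF bF] poly[OF FV(1)] by simp
    then show ?thesis
      unfolding moment_vector_def using bF closure len
      by (intro orientation_sign_cross) (auto simp: lattice_basis_def)
  qed
  let ?L = "\<lambda>u. generalized_cross (((x - A) # b G) @ [u]) J"
  have lin: "linear ?L"
    by (rule linear_generalized_cross_last)
  have "balanced_at k V w G"
    using trop G by (simp add: tropical_variety_def)
  then have "(\<Sum>F\<in>?star. real (w F) *\<^sub>R v F) \<in> span (set (b G))"
    unfolding spanG balanced_at_def using prim by blast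
  \<comment> \<open>Balancing puts the weighted sum into the span of the basis of G alone; the cross
    product also carries x - A, which only enlarges the span.\<close>
  then have "(\<Sum>F\<in>?star. real (w F) *\<^sub>R v F) \<in> span (set ((x - A) # b G))"
    using span_mono[of "set (b G)" "set ((x - A) # b G)"] by auto
  then have "?L (\<Sum>F\<in>?star. real (w F) *\<^sub>R v F) = 0"
    by (rule generalized_cross_last_in_span)
  then have "(\<Sum>F\<in>?star. real (w F) * ?L (v F)) = 0"
    by (simp only: linear_sum[OF lin] linear_scale[OF lin] real_scaleR_def)
  moreover have "(\<Sum>F\<in>?star.
        of_int (orientation_sign (b G) (v F) (b F)) * (real (w F) * moment_vector A (p F) (b F) J))
      = (\<Sum>F\<in>?star. real (w F) * ?L (v F))"
    using flip by (intro sum.cong refl) (simp add: mult.left_commute)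
  ultimately show ?thesis
    by simp
qed

lemma face_chain_carrier:
  "face_chain k V b v F \<in> carrier (free_Abelian_group (codim_one_faces k V))"
  unfolding face_chain_def by (intro sum_closed_free_Abelian_group) auto

theorem proposition2p5:
  fixes V :: "'n::{finite,linorder} rvec set set"
    and w :: "'n rvec set \<Rightarrow> nat"
    and b :: "'n rvec set \<Rightarrow> 'n rvec list"
    and v :: "'n rvec set \<Rightarrow> 'n rvec set \<Rightarrow> 'n rvec"
    and p :: "'n rvec set \<Rightarrow> 'n rvec"
    and A :: "'n rvec"
    and k :: nat
  assumes "k < CARD('n)"
    and "tropical_variety k V w"
    and "\<And>S. S \<in> maximal_faces k V \<union> codim_one_faces k V \<Longrightarrow> lattice_basis S (b S)"
    and "\<And>F G. F \<in> maximal_faces k V \<Longrightarrow> G \<in> codim_one_faces k V \<Longrightarrow> G \<subseteq> F \<Longrightarrow>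
           primitive_vector G F (v G F)"
    and "\<And>F. F \<in> maximal_faces k V \<Longrightarrow> p F \<in> F"
  shows "finprod (moment_group k V b v) (rho k V w b v p A)
           {F \<in> maximal_faces k V. \<not> bounded F} = \<one>\<^bsub>moment_group k V b v\<^esub>"
proof -
  let ?M = "maximal_faces k V" and ?C = "codim_one_faces k V"
  let ?E = "minor_space (k + 1) :: ('n set \<Rightarrow> real) monoid"
  let ?R = "bounded_relations k V b v" and ?B = "codim_one_group k V b v"
  let ?s = "\<lambda>F G. orientation_sign (b G) (v G F) (b F)"
  let ?T = "pure_tensor ?E ?B"
  define cls where "cls = presented_class ?C ?R"
  define r where "r = (\<lambda>F J. real (w F) * moment_vector A (p F) (b F) J)"
  \<comment> \<open>The sign is already moved to the left factor, and extension by zero to all pairs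
    (F, G) makes the double product rectangular, so that its order can be exchanged.\<close>
  define c where "c = (\<lambda>F G J. if G \<subseteq> F then of_int (?s F G) * r F J else 0)"

  have complex: "rational_polyhedral_complex V"
    using assms(2) by (simp add: tropical_variety_def)
  then have fin: "finite ?M" "finite ?C"
    by (auto simp: rational_polyhedral_complex_def faces_of_dim_def)
  \<comment> \<open>With the vector from A in front there are k + 1 rows, so the moments lie in
    \<open>minor_space (k + 1)\<close>.\<close>
  have "length (b F) = k" if "F \<in> ?M" for F
    using lattice_basis_length[OF assms(3)[of F]] complex that
    by (auto simp: rational_polyhedral_complex_def faces_of_dim_def)
  then have r: "r F \<in> carrier ?E" if "F \<in> ?M" for F
    using that by (auto simp: r_def moment_vector_def generalized_cross_def)
  then have c: "c F G \<in> carrier ?E" if "F \<in> ?M" for F G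
    using that by (auto simp: c_def)

  have R: "?R \<subseteq> carrier (free_Abelian_group ?C)"
    unfolding bounded_relations_def using face_chain_carrier by blast
  have cls_hom: "cls \<in> hom (free_Abelian_group ?C) ?B"
    unfolding cls_def codim_one_group_def by (rule presented_class_hom[OF R])
  interpret E: comm_group ?E
    by (rule comm_group_minor_space)
  interpret B: comm_group ?B
    unfolding codim_one_group_def by (rule comm_group_presented_group[OF R])
  note mon = E.monoid_axioms B.monoid_axioms
  interpret T: comm_group "moment_group k V b v"
    unfolding moment_group_def by (rule comm_group_tensor_group[OF mon])
  have T_left: "(\<lambda>a. ?T a y) \<in> hom ?E (moment_group k V b v)" if "y \<in> carrier ?B" for y
    unfolding moment_group_def by (rule pure_tensor_hom_left[OF mon that])
  have T_right: "?T a \<in> hom ?B (moment_group k V b v)" if "a \<in> carrier ?E" for a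
    unfolding moment_group_def by (rule pure_tensor_hom_right[OF mon that])
  have cls_closed: "cls y \<in> carrier ?B" if "Poly_Mapping.keys y \<subseteq> ?C" for y
    using hom_in_carrier[OF cls_hom] that by simp
  have T_closed: "?T a (cls y) \<in> carrier (moment_group k V b v)"
    if "a \<in> carrier ?E" "Poly_Mapping.keys y \<subseteq> ?C" for a y
    by (rule hom_in_carrier[OF T_right[OF that(1)] cls_closed[OF that(2)]])
  have T_zero: "?T (\<lambda>_. 0) y = \<one>\<^bsub>moment_group k V b v\<^esub>" if "y \<in> carrier ?B" for y
    using hom_one[OF T_left[OF that] E.group_axioms T.group_axioms] by simp

  have rho: "rho k V w b v p A F = ?T (r F) (cls (face_chain k V b v F))" for F
    by (simp add: rho_def r_def cls_def face_element_def)
  have rho_closed: "rho k V w b v p A F \<in> carrier (moment_group k V b v)" if "F \<in> ?M" for F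
    unfolding rho using face_chain_carrier[of k V b v F] by (intro T_closed r that) simp
  have rho_bounded: "rho k V w b v p A F = \<one>\<^bsub>moment_group k V b v\<^esub>" if "F \<in> ?M" "bounded F" for F
  proof -
    have "cls (face_chain k V b v F) = \<one>\<^bsub>?B\<^esub>"
      unfolding cls_def codim_one_group_def using that
      by (intro presented_class_relation[OF R]) (auto simp: bounded_relations_def)
    then show ?thesis
      using hom_one[OF T_right[OF r[OF that(1)]] B.group_axioms T.group_axioms] by (simp add: rho)
  qed
  have rho_expand: "rho k V w b v p A F
      = (\<Otimes>\<^bsub>moment_group k V b v\<^esub>G\<in>?C. ?T (c F G) (cls (frag_of G)))" if F: "F \<in> ?M" for F
  proof -
    let ?D = "{G \<in> ?C. G \<subseteq> F}"
    let ?f = "\<lambda>G. frag_cmul (?s F G) (frag_of G)"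
    have f: "?f G \<in> carrier (free_Abelian_group ?C)" if "G \<in> ?D" for G
      using that by auto
    have chain: "face_chain k V b v F = finprod (free_Abelian_group ?C) ?f ?D"
      unfolding face_chain_def using f by (intro finprod_free_Abelian_group[symmetric]) simp
    have cls_chain: "cls (finprod (free_Abelian_group ?C) ?f ?D) = finprod ?B (\<lambda>G. cls (?f G)) ?D"
      by (rule hom_finprod[OF abelian_free_Abelian_group B.comm_group_axioms cls_hom f])
    have T_chain: "?T (r F) (finprod ?B (\<lambda>G. cls (?f G)) ?D)
        = (\<Otimes>\<^bsub>moment_group k V b v\<^esub>G\<in>?D. ?T (r F) (cls (?f G)))"
      using f by (intro hom_finprod[OF B.comm_group_axioms T.comm_group_axioms T_right[OF r[OF F]]]
          cls_closed) simp
    have "rho k V w b v p A F = (\<Otimes>\<^bsub>moment_group k V b v\<^esub>G\<in>?D. ?T (r F) (cls (?f G)))"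
      by (simp only: rho chain cls_chain T_chain)
    also have "\<dots> = (\<Otimes>\<^bsub>moment_group k V b v\<^esub>G\<in>?C. ?T (c F G) (cls (frag_of G)))"
    \<comment> \<open>On faces of F the sign crosses the tensor; on the remaining G the left factor
      is zero and the tensor is neutral.\<close>
    proof (rule T.finprod_mono_neutral_cong_left[OF fin(2)])
      fix G assume G: "G \<in> ?D"
      have "?T (r F) (cls (?f G)) = ?T (\<lambda>J. of_int (?s F G) * r F J) (cls (frag_of G))"
        using G by (intro pure_tensor_sign[OF B.comm_group_axioms r[OF F] cls_hom])
          (auto simp: orientation_sign_def)
      then show "?T (r F) (cls (?f G)) = ?T (c F G) (cls (frag_of G))"
        using G by (simp add: c_def)
    next
      fix G assume G: "G \<in> ?C - ?D"
      then have "c F G = (\<lambda>_. 0)"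
        by (auto simp: c_def)
      then show "?T (c F G) (cls (frag_of G)) = \<one>\<^bsub>moment_group k V b v\<^esub>"
        using G T_zero[OF cls_closed[of "frag_of G"]] by simp
    next
      show "(\<lambda>G. ?T (c F G) (cls (frag_of G))) \<in> ?C \<rightarrow> carrier (moment_group k V b v)"
        by (intro Pi_I T_closed c F) simp
    qed blast
    finally show ?thesis .
  qed
  have column: "(\<Otimes>\<^bsub>moment_group k V b v\<^esub>F\<in>?M. ?T (c F G) (cls (frag_of G))) = \<one>\<^bsub>moment_group k V b v\<^esub>"
    if G: "G \<in> ?C" for G
  proof -
    have y: "cls (frag_of G) \<in> carrier ?B" using G by (intro cls_closed) simp
    have "(\<Sum>F\<in>?M. c F G J) = 0" for J
    proof -
      have "(\<Sum>F\<in>?M. c F G J) = (\<Sum>F\<in>{F \<in> ?M. G \<subseteq> F}. of_int (?s F G) * r F J)"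
        unfolding c_def using fin(1) by (simp add: sum.inter_filter)
      also have "\<dots> = 0"
        unfolding r_def using assms(4)[OF _ G] by (intro balanced_moments assms(2,3,5) G)
      finally show ?thesis .
    qed
    \<comment> \<open>Every minor of the sum vanishes, so additivity in the left factor turns the
      product over F into a tensor with zero.\<close>
    then have "finprod ?E (\<lambda>F. c F G) ?M = (\<lambda>_. 0)"
      by (subst finprod_minor_space[OF c]) auto
    then show ?thesis
      using hom_finprod[OF E.comm_group_axioms T.comm_group_axioms T_left[OF y], of ?M "\<lambda>F. c F G"]
        c T_zero[OF y] by simp
  qed

  have "finprod (moment_group k V b v) (rho k V w b v p A) {F \<in> ?M. \<not> bounded F}
      = finprod (moment_group k V b v) (rho k V w b v p A) ?M"
    using rho_closed rho_bounded by (intro T.finprod_mono_neutral_cong_left fin) auto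
  also have "\<dots> = (\<Otimes>\<^bsub>moment_group k V b v\<^esub>F\<in>?M. \<Otimes>\<^bsub>moment_group k V b v\<^esub>G\<in>?C. ?T (c F G) (cls (frag_of G)))"
    by (intro T.finprod_cong' refl Pi_I T.finprod_closed T_closed c rho_expand) auto
  also have "\<dots> = (\<Otimes>\<^bsub>moment_group k V b v\<^esub>G\<in>?C. \<Otimes>\<^bsub>moment_group k V b v\<^esub>F\<in>?M. ?T (c F G) (cls (frag_of G)))"
    by (intro T.finprod_swap fin T_closed c) auto
  also have "\<dots> = \<one>\<^bsub>moment_group k V b v\<^esub>"
    by (intro T.finprod_one_eqI column)
  finally show ?thesis .
qed

end
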